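(* Let $(X,\mathcal B_X)$ and $(Y,\mathcal D)$ be measurable spaces, let $F:X\times Y\to X$ be measurable, and write $F_y=F(\cdot,y)$. Let $\nu$ be a probability measure on $(Y,\mathcal D)$, and let $\times_{n=0}^\infty\nu$ be the corresponding infinite product measure on $\Omega_Y=\prod_{n=0}^\infty Y$ with its cylinder sigma-algebra. For $\omega=(y_0,y_1,\ldots)\in\Omega_Y$ set $$F_{\omega|_n}=F_{y_n}F_{y_{n-1}}\cdots F_{y_1}F_{y_0}.$$ Assume that for $\omega\in\Omega_Y$ the set $$\bigcap_{n=1}^\infty F_{\omega|_n}(X)=\{x_\omega\}$$ is a singleton, and let $V:\Omega_Y\to X$ be defined by $V(\omega)=x_\omega$. Then the formula $$\mu(B)=\left(\times_{n=0}^\infty\nu\right)(V^{-1}(B)),\qquad B\in\mathcal B_X,$$ defines a measure on $(X,\mathcal B_X)$ which satisfies $\mu R_F=\mu$, that is, $$\iint_{X\times Y}f(F(x,y))\,d\nu(y)\,d\mu(x)=\int_Xf(x)\,d\mu(x),\qquad\forall f\in\mathcal M(X,\mathcal B_X).$$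
   Context: $\mathcal M(X,\mathcal B_X)$ denotes the space of real-valued measurable functions on $X$. The transfer operator is $(R_Ff)(x)=\int_Yf(F(x,y))\,d\nu(y)$, and $\mu R_F$ is the measure determined by $\int_Xf\,d(\mu R_F)=\int_XR_Ff\,d\mu$. Products such as $F_{y_n}F_{y_{n-1}}\cdots F_{y_0}$ denote composition of maps, so that $F_{y_0}$ is applied first. *)

theory Defs
  imports "HOL-Probability.Probability"
begin

text \<open>\<open>iterated_map F \<omega> n\<close> is the composition of the maps \<open>F (_, \<omega> 0), \<dots>, F (_, \<omega> n)\<close>
  (\<open>n + 1\<close> maps), the one with parameter \<open>\<omega> 0\<close> being applied first.\<close>

primrec iterated_map :: "('a \<times> 'b \<Rightarrow> 'a) \<Rightarrow> (nat \<Rightarrow> 'b) \<Rightarrow> nat \<Rightarrow> 'a \<Rightarrow> 'a" where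
  "iterated_map F \<omega> 0 = (\<lambda>x. F (x, \<omega> 0))"
| "iterated_map F \<omega> (Suc n) = (\<lambda>x. F (x, \<omega> (Suc n))) \<circ> iterated_map F \<omega> n"

definition transfer_operator ::
    "('a \<times> 'b \<Rightarrow> 'a) \<Rightarrow> 'b measure \<Rightarrow> ('a \<Rightarrow> real) \<Rightarrow> 'a \<Rightarrow> real" where
  "transfer_operator F \<nu> f x = (\<integral>y. f (F (x, y)) \<partial>\<nu>)"

text \<open>The measure \<open>\<mu> R\<^sub>F\<close> is determined by \<open>\<integral> f d(\<mu> R\<^sub>F) = \<integral> R\<^sub>F f d\<mu>\<close>. The definition is the case
  where \<open>f\<close> is the indicator function of a measurable set; \<open>integral_transfer_measure\<close> below
  recovers the general case.\<close>

definition transfer_measure ::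
    "('a \<times> 'b \<Rightarrow> 'a) \<Rightarrow> 'b measure \<Rightarrow> 'a measure \<Rightarrow> 'a measure" where
  "transfer_measure F \<nu> \<mu> = measure_of (space \<mu>) (sets \<mu>)
     (\<lambda>B. \<integral>\<^sup>+ x. ennreal (transfer_operator F \<nu> (indicator B) x) \<partial>\<mu>)"

lemma sets_transfer_measure [simp]: "sets (transfer_measure F \<nu> \<mu>) = sets \<mu>"
  by (simp add: transfer_measure_def)

lemma space_transfer_measure [simp]: "space (transfer_measure F \<nu> \<mu>) = space \<mu>"
  by (simp add: transfer_measure_def)

lemma transfer_measure_eq_distr:
  assumes "prob_space \<nu>" "F \<in> measurable (\<mu> \<Otimes>\<^sub>M \<nu>) \<mu>"
  shows "transfer_measure F \<nu> \<mu> = distr (\<mu> \<Otimes>\<^sub>M \<nu>) \<mu> F"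
proof -
  interpret prob_space \<nu> by fact
  have eq: "(\<integral>\<^sup>+ x. ennreal (transfer_operator F \<nu> (indicator B) x) \<partial>\<mu>)
      = emeasure (\<mu> \<Otimes>\<^sub>M \<nu>) (F -` B \<inter> space (\<mu> \<Otimes>\<^sub>M \<nu>))" if B: "B \<in> sets \<mu>" for B
  proof -
    have S: "F -` B \<inter> space (\<mu> \<Otimes>\<^sub>M \<nu>) \<in> sets (\<mu> \<Otimes>\<^sub>M \<nu>)"
      using assms(2) B by (rule measurable_sets)
    have "ennreal (transfer_operator F \<nu> (indicator B) x)
        = emeasure \<nu> (Pair x -` (F -` B \<inter> space (\<mu> \<Otimes>\<^sub>M \<nu>)))" if x: "x \<in> space \<mu>" for x
    proof -
      have "transfer_operator F \<nu> (indicator B) x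
          = (\<integral>y. indicator (Pair x -` (F -` B \<inter> space (\<mu> \<Otimes>\<^sub>M \<nu>))) y \<partial>\<nu>)"
        unfolding transfer_operator_def
        by (rule Bochner_Integration.integral_cong)
          (auto simp: indicator_def space_pair_measure x)
      also have "\<dots> = measure \<nu> (Pair x -` (F -` B \<inter> space (\<mu> \<Otimes>\<^sub>M \<nu>)))"
        using sets_Pair1[OF S, of x] by simp
      finally show ?thesis by (simp add: emeasure_eq_measure)
    qed
    then show ?thesis
      by (simp add: emeasure_pair_measure_alt[OF S] cong: nn_integral_cong)
  qed
  show ?thesis
    unfolding transfer_measure_def distr_def
    using eq by (intro measure_of_eq[OF sets.space_closed]) (simp add: sets.sigma_sets_eq)
qed

lemma integral_transfer_measure:
  fixes f :: "'a \<Rightarrow> real"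
  assumes "prob_space \<nu>" "sigma_finite_measure \<mu>" "F \<in> measurable (\<mu> \<Otimes>\<^sub>M \<nu>) \<mu>"
    and f: "integrable (transfer_measure F \<nu> \<mu>) f"
  shows "(\<integral>x. f x \<partial>transfer_measure F \<nu> \<mu>) = (\<integral>x. transfer_operator F \<nu> f x \<partial>\<mu>)"
proof -
  interpret \<nu>: prob_space \<nu> by fact
  interpret \<mu>: sigma_finite_measure \<mu> by fact
  interpret pair_sigma_finite \<mu> \<nu> ..
  have fm: "f \<in> borel_measurable \<mu>"
    using borel_measurable_integrable[OF f] by (simp cong: measurable_cong_sets)
  have int: "integrable (\<mu> \<Otimes>\<^sub>M \<nu>) (\<lambda>p. f (F p))"
    using f by (simp add: transfer_measure_eq_distr assms integrable_distr_eq fm)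
  show ?thesis
    using integral_fst'[OF int]
    by (simp add: transfer_measure_eq_distr assms integral_distr fm transfer_operator_def)
qed

end

theory Submission imports Defs begin

text \<open>
  The intersection hypothesis, imposed on every sequence of parameters, forces the coding map
  \<open>V\<close> to be constant. The composition \<open>F\<^bsub>\<omega> n\<^esub> \<circ> \<dots> \<circ> F\<^bsub>\<omega> 0\<^esub>\<close> ends with the most recent parameter, so
  its range lies in the range of \<open>F\<^bsub>\<omega> n\<^esub> \<circ> \<dots> \<circ> F\<^bsub>\<omega> m\<^esub>\<close> for each \<open>m \<le> n\<close>. Hence \<open>V \<omega>\<close> lies in the range
  of the composition along every word that occurs in \<open>\<omega>\<close> and ends at a positive index.

  Along the constant sequence \<open>y, y, \<dots>\<close> the ranges decrease and \<open>F\<^sub>y\<close> maps their intersection into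
  itself, so the only point of the intersection is fixed by \<open>F\<^sub>y\<close>. Given two parameters \<open>y\<close>
  and \<open>z\<close>, some sequence contains arbitrarily long blocks of \<open>y\<close> as well as of \<open>z\<close>; its value under
  \<open>V\<close> is the point of the constant sequence \<open>y\<close> and also that of the constant sequence \<open>z\<close>. Thus
  all maps \<open>F\<^sub>y\<close> have one common fixed point \<open>c\<close>. A common fixed point lies in every range, so
  \<open>V \<omega> = c\<close> for every \<open>\<omega>\<close>.

  The distribution of \<open>V\<close> is therefore the Dirac measure at \<open>c\<close>, which is invariant because
  \<open>F (c, y) = c\<close> for every \<open>y\<close>.
\<close>

lemma iterated_map_add:
  "iterated_map F \<omega> (Suc m + n) = iterated_map F (\<lambda>i. \<omega> (Suc m + i)) n \<circ> iterated_map F \<omega> m"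
  by (induction n) (auto simp: fun_eq_iff)

lemma iterated_map_cong:
  assumes "\<And>i. i \<le> n \<Longrightarrow> \<omega> i = \<omega>' i"
  shows "iterated_map F \<omega> n = iterated_map F \<omega>' n"
  using assms by (induction n) auto

lemma iterated_map_closed:
  assumes "\<And>x y. x \<in> S \<Longrightarrow> y \<in> T \<Longrightarrow> F (x, y) \<in> S" and "\<And>i. \<omega> i \<in> T" and "x \<in> S"
  shows "iterated_map F \<omega> n x \<in> S"
  using assms by (induction n) auto

lemma iterated_map_fixed_point:
  assumes "\<And>i. F (c, \<omega> i) = c"
  shows "iterated_map F \<omega> n c = c"
  using assms by (induction n) auto

text \<open>Forgetting the parameters that act before a word can only enlarge the range.\<close>

lemma range_iterated_map_subset_word:
  assumes closed: "\<And>x y. x \<in> S \<Longrightarrow> y \<in> T \<Longrightarrow> F (x, y) \<in> S" and \<omega>: "\<And>i. \<omega> i \<in> T"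
    and word: "\<And>i. i \<le> n \<Longrightarrow> \<omega> (Suc m + i) = w i"
  shows "iterated_map F \<omega> (Suc m + n) ` S \<subseteq> iterated_map F w n ` S"
proof -
  have "iterated_map F (\<lambda>i. \<omega> (Suc m + i)) n = iterated_map F w n"
    using word by (rule iterated_map_cong)
  moreover have "iterated_map F \<omega> m ` S \<subseteq> S"
    using iterated_map_closed[of S T F \<omega>] closed \<omega> by blast
  ultimately show ?thesis
    unfolding iterated_map_add by (auto simp: image_comp[symmetric])
qed

text \<open>
  The point coded by \<open>\<omega>\<close> lies in the range along each of its \<open>y\<close>-blocks, hence in all the ranges whose
  intersection is the point coded by the constant sequence. The blocks start at a positive index
  \<open>Suc m\<close> so that there is a composition \<open>iterated_map F \<omega> m\<close> to forget.
\<close>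

lemma code_eq_constant_code:
  assumes closed: "\<And>x y. x \<in> S \<Longrightarrow> y \<in> T \<Longrightarrow> F (x, y) \<in> S" and \<omega>: "\<And>i. \<omega> i \<in> T"
    and code: "(\<Inter>n\<in>{1..}. iterated_map F \<omega> n ` S) = {v}"
    and const: "(\<Inter>n\<in>{1..}. iterated_map F (\<lambda>_. y) n ` S) = {p}"
    and blocks: "\<And>n. \<exists>m. \<forall>i\<le>n. \<omega> (Suc m + i) = y"
  shows "v = p"
proof -
  have "v \<in> iterated_map F (\<lambda>_. y) n ` S" if "n \<ge> 1" for n
  proof -
    obtain m where m: "\<And>i. i \<le> n \<Longrightarrow> \<omega> (Suc m + i) = y" using blocks by blast
    have "v \<in> iterated_map F \<omega> (Suc m + n) ` S" using code by fastforce
    then show ?thesis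
      using range_iterated_map_subset_word[of S T F \<omega> n m "\<lambda>_. y", OF closed \<omega> m] by blast
  qed
  then have "v \<in> (\<Inter>n\<in>{1..}. iterated_map F (\<lambda>_. y) n ` S)" by simp
  then show ?thesis unfolding const by simp
qed

text \<open>
  Applying \<open>F (_, y)\<close> moves each range to the next one; since the ranges decrease, their intersection is
  mapped into itself.
\<close>

lemma constant_code_fixed:
  assumes closed: "\<And>x y. x \<in> S \<Longrightarrow> y \<in> T \<Longrightarrow> F (x, y) \<in> S" and y: "y \<in> T"
    and const: "(\<Inter>n\<in>{1..}. iterated_map F (\<lambda>_. y) n ` S) = {p}"
  shows "F (p, y) = p"
proof -
  have "F (p, y) \<in> iterated_map F (\<lambda>_. y) n ` S" if "n \<ge> 1" for n
  proof -
    have "p \<in> iterated_map F (\<lambda>_. y) n ` S" using const that by blast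
    then have "F (p, y) \<in> iterated_map F (\<lambda>_. y) (Suc n) ` S" by auto
    then show ?thesis
      using range_iterated_map_subset_word[of S T F "\<lambda>_. y" n 0 "\<lambda>_. y"] closed y by auto
  qed
  then have "F (p, y) \<in> (\<Inter>n\<in>{1..}. iterated_map F (\<lambda>_. y) n ` S)" by simp
  then show ?thesis unfolding const by simp
qed

lemma sequence_with_long_blocks:
  "\<exists>\<omega>. (\<forall>i. \<omega> i \<in> {y, z}) \<and> (\<forall>n. \<exists>m. \<forall>i\<le>n. \<omega> (Suc m + i) = y)
    \<and> (\<forall>n. \<exists>m. \<forall>i\<le>n. \<omega> (Suc m + i) = z)"
proof -
  \<comment> \<open>The value is \<open>y\<close> when the binary length of the index is odd, and \<open>z\<close> when it is even:
    the \<open>y\<close>-blocks start at \<open>4 ^ n\<close> and the \<open>z\<close>-blocks at \<open>2 * 4 ^ n\<close>.\<close>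
  define \<omega> where "\<omega> k = (if \<exists>m. 4 ^ m \<le> k \<and> k < 2 * 4 ^ m then y else z)" for k :: nat
  have less: "n < 4 ^ n" for n :: nat by (rule power_gt_expt) simp
  have vals: "\<omega> i \<in> {y, z}" for i by (simp add: \<omega>_def)
  have blocks_y: "\<exists>m. \<forall>i\<le>n. \<omega> (Suc m + i) = y" for n
  proof (intro exI allI impI)
    fix i assume "i \<le> n"
    then have "4 ^ n \<le> 4 ^ n + i \<and> 4 ^ n + i < 2 * 4 ^ n"
      using less[of n] by simp
    then have "\<exists>m. 4 ^ m \<le> 4 ^ n + i \<and> 4 ^ n + i < 2 * 4 ^ m" ..
    then show "\<omega> (Suc (4 ^ n - 1) + i) = y"
      unfolding \<omega>_def by simp
  qed
  have blocks_z: "\<exists>m. \<forall>i\<le>n. \<omega> (Suc m + i) = z" for n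
  proof (intro exI allI impI)
    fix i assume i: "i \<le> n"
    have "\<not> (4 ^ m \<le> 2 * 4 ^ n + i \<and> 2 * 4 ^ n + i < 2 * 4 ^ m)" for m
    proof (cases "m \<le> n")
      case True
      then have "(4::nat) ^ m \<le> 4 ^ n" by (simp add: power_increasing)
      then show ?thesis by linarith
    next
      case False
      then have "(4::nat) ^ Suc n \<le> 4 ^ m" by (intro power_increasing) auto
      then show ?thesis using i less[of n] by simp
    qed
    then have "\<omega> (2 * 4 ^ n + i) = z"
      unfolding \<omega>_def by metis
    then show "\<omega> (Suc (2 * 4 ^ n - 1) + i) = z" by simp
  qed
  show ?thesis
    by (intro exI[of _ \<omega>] conjI allI vals blocks_y blocks_z)
qed

text \<open>
  Comparing each parameter with one reference parameter \<open>y0\<close>, through a sequence with long blocks of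
  both, shows that the fixed points of all the maps agree.
\<close>

lemma code_constant:
  assumes closed: "\<And>x y. x \<in> S \<Longrightarrow> y \<in> T \<Longrightarrow> F (x, y) \<in> S" and "T \<noteq> {}"
    and code: "\<And>\<omega>. (\<And>i. \<omega> i \<in> T) \<Longrightarrow> (\<Inter>n\<in>{1..}. iterated_map F \<omega> n ` S) = {V \<omega>}"
  shows "\<exists>c\<in>S. (\<forall>y\<in>T. F (c, y) = c) \<and> (\<forall>\<omega>. (\<forall>i. \<omega> i \<in> T) \<longrightarrow> V \<omega> = c)"
proof -
  obtain y0 where y0: "y0 \<in> T" using \<open>T \<noteq> {}\<close> by blast
  define c where "c = V (\<lambda>_. y0)"
  have "c \<in> (\<Inter>n\<in>{1..}. iterated_map F (\<lambda>_. y0) n ` S)"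
    unfolding c_def code[of "\<lambda>_. y0", OF y0] by simp
  then have "c \<in> iterated_map F (\<lambda>_. y0) 1 ` S" by (rule INT_D) simp
  moreover have "iterated_map F (\<lambda>_. y0) 1 ` S \<subseteq> S"
    using closed y0 by auto
  ultimately have cS: "c \<in> S" by blast
  have fixed: "F (c, y) = c" if y: "y \<in> T" for y
  proof -
    obtain \<omega> where \<omega>: "\<forall>i. \<omega> i \<in> {y0, y}"
      and b0: "\<forall>n. \<exists>m. \<forall>i\<le>n. \<omega> (Suc m + i) = y0" and b: "\<forall>n. \<exists>m. \<forall>i\<le>n. \<omega> (Suc m + i) = y"
      using sequence_with_long_blocks[of y0 y] by (elim exE conjE)
    have \<omega>T: "\<omega> i \<in> T" for i using spec[OF \<omega>, of i] y y0 by auto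
    have "V \<omega> = V (\<lambda>_. y0)"
      by (rule code_eq_constant_code[OF closed \<omega>T code[OF \<omega>T] code[OF y0] spec[OF b0]])
    moreover have "V \<omega> = V (\<lambda>_. y)"
      by (rule code_eq_constant_code[OF closed \<omega>T code[OF \<omega>T] code[OF y] spec[OF b]])
    moreover have "F (V (\<lambda>_. y), y) = V (\<lambda>_. y)"
      by (rule constant_code_fixed[OF closed y code[OF y]])
    ultimately show ?thesis by (simp add: c_def)
  qed
  have "V \<omega> = c" if \<omega>: "\<And>i. \<omega> i \<in> T" for \<omega>
  proof -
    have "c = iterated_map F \<omega> n c" for n
      using iterated_map_fixed_point[of F c \<omega> n] fixed \<omega> by simp
    then have "c \<in> (\<Inter>n\<in>{1..}. iterated_map F \<omega> n ` S)" using cS by blast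
    then show ?thesis unfolding code[OF \<omega>] by simp
  qed
  then show ?thesis using cS fixed by blast
qed

text \<open>The slice at \<open>c\<close> of the preimage of a set under \<open>F\<close> is all of \<open>space \<nu>\<close> or empty.\<close>

lemma transfer_measure_return:
  assumes \<nu>: "prob_space \<nu>" and F: "F \<in> measurable (X \<Otimes>\<^sub>M \<nu>) X" and c: "c \<in> space X"
    and fixed: "\<And>y. y \<in> space \<nu> \<Longrightarrow> F (c, y) = c"
  shows "transfer_measure F \<nu> (return X c) = return X c"
proof (rule measure_eqI)
  interpret \<nu>: prob_space \<nu> by fact
  let ?\<mu> = "return X c"
  have sets_pair: "sets (?\<mu> \<Otimes>\<^sub>M \<nu>) = sets (X \<Otimes>\<^sub>M \<nu>)"
    by (rule sets_pair_measure_cong) simp_all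
  have F': "F \<in> measurable (?\<mu> \<Otimes>\<^sub>M \<nu>) ?\<mu>"
    using F sets_pair by (simp cong: measurable_cong_sets)
  fix B assume "B \<in> sets (transfer_measure F \<nu> ?\<mu>)"
  then have B: "B \<in> sets X" by simp
  let ?E = "F -` B \<inter> space (?\<mu> \<Otimes>\<^sub>M \<nu>)"
  have E: "?E \<in> sets (?\<mu> \<Otimes>\<^sub>M \<nu>)" by (rule measurable_sets[OF F']) (simp add: B)
  have slice: "Pair c -` ?E = (if c \<in> B then space \<nu> else {})"
    using c fixed by (auto simp: space_pair_measure)
  have "emeasure (transfer_measure F \<nu> ?\<mu>) B = emeasure (?\<mu> \<Otimes>\<^sub>M \<nu>) ?E"
    using F' B by (simp add: transfer_measure_eq_distr \<nu> emeasure_distr)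
  also have "\<dots> = (\<integral>\<^sup>+x. emeasure \<nu> (Pair x -` ?E) \<partial>?\<mu>)"
    by (rule \<nu>.emeasure_pair_measure_alt[OF E])
  also have "\<dots> = emeasure \<nu> (Pair c -` ?E)"
    using \<nu>.measurable_emeasure_Pair[OF E] c
    by (intro nn_integral_return) (simp_all cong: measurable_cong_sets)
  also have "\<dots> = emeasure ?\<mu> B"
    using B unfolding slice by (simp add: \<nu>.emeasure_space_1)
  finally show "emeasure (transfer_measure F \<nu> ?\<mu>) B = emeasure ?\<mu> B" .
qed simp

theorem theorem2p29:
  fixes X :: "'a measure" and \<nu> :: "'b measure"
    and F :: "'a \<times> 'b \<Rightarrow> 'a" and V :: "(nat \<Rightarrow> 'b) \<Rightarrow> 'a"
  assumes "prob_space \<nu>"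
    and "F \<in> measurable (X \<Otimes>\<^sub>M \<nu>) X"
    and "\<forall>\<omega> \<in> space (Pi\<^sub>M (UNIV :: nat set) (\<lambda>_. \<nu>)).
           (\<Inter>n\<in>{1..}. iterated_map F \<omega> n ` space X) = {V \<omega>}"
  shows "let P = Pi\<^sub>M (UNIV :: nat set) (\<lambda>_. \<nu>); \<mu> = distr P X V in
    V \<in> measurable P X \<and>
    (\<forall>B\<in>sets X. emeasure \<mu> B = emeasure P (V -` B \<inter> space P)) \<and>
    transfer_measure F \<nu> \<mu> = \<mu> \<and>
    (\<forall>f :: 'a \<Rightarrow> real. f \<in> borel_measurable X \<longrightarrow>
      (integrable (\<mu> \<Otimes>\<^sub>M \<nu>) (\<lambda>(x, y). f (F (x, y))) \<longleftrightarrow> integrable \<mu> f) \<and>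
      (\<integral>x. (\<integral>y. f (F (x, y)) \<partial>\<nu>) \<partial>\<mu>) = (\<integral>x. f x \<partial>\<mu>))"
proof -
  interpret \<nu>: prob_space \<nu> by fact
  note F = assms(2)
  let ?P = "Pi\<^sub>M (UNIV :: nat set) (\<lambda>_. \<nu>)"
  interpret P: prob_space ?P by (rule prob_space_PiM) (rule assms(1))
  have space_P: "\<omega> \<in> space ?P \<longleftrightarrow> (\<forall>i. \<omega> i \<in> space \<nu>)" for \<omega>
    by (simp add: space_PiM PiE_UNIV_domain Pi_iff)
  have closed: "F (x, y) \<in> space X" if "x \<in> space X" "y \<in> space \<nu>" for x y
    using measurable_space[OF F] that by (simp add: space_pair_measure)
  have code: "(\<Inter>n\<in>{1..}. iterated_map F \<omega> n ` space X) = {V \<omega>}"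
    if "\<And>i. \<omega> i \<in> space \<nu>" for \<omega>
    using assms(3) that by (simp add: space_P)
  obtain c where c: "c \<in> space X" and fixed: "\<forall>y\<in>space \<nu>. F (c, y) = c"
    and V: "\<forall>\<omega>. (\<forall>i. \<omega> i \<in> space \<nu>) \<longrightarrow> V \<omega> = c"
    using code_constant[of "space X" "space \<nu>" F V, OF closed \<nu>.not_empty code] by blast
  have Vc: "V \<omega> = c" if "\<omega> \<in> space ?P" for \<omega> using V that by (simp add: space_P)
  have V_meas: "V \<in> measurable ?P X"
    using c Vc by (simp cong: measurable_cong)
  define \<mu> where "\<mu> = distr ?P X V"
  have "\<mu> = distr ?P X (\<lambda>_. c)"
    unfolding \<mu>_def by (rule distr_cong) (simp_all add: Vc)
  then have \<mu>: "\<mu> = return X c"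
    using c by (simp add: P.distr_const)
  have inv: "transfer_measure F \<nu> \<mu> = \<mu>"
    unfolding \<mu> using transfer_measure_return[OF assms(1) F c] fixed by blast
  have sets_pair: "sets (\<mu> \<Otimes>\<^sub>M \<nu>) = sets (X \<Otimes>\<^sub>M \<nu>)"
    by (rule sets_pair_measure_cong) (simp_all add: \<mu>)
  have F': "F \<in> measurable (\<mu> \<Otimes>\<^sub>M \<nu>) \<mu>"
    using F sets_pair by (simp add: \<mu> cong: measurable_cong_sets)
  have distr_F: "distr (\<mu> \<Otimes>\<^sub>M \<nu>) \<mu> F = \<mu>"
    using transfer_measure_eq_distr[OF assms(1) F'] inv by simp
  have "integrable (\<mu> \<Otimes>\<^sub>M \<nu>) (\<lambda>(x, y). f (F (x, y))) \<longleftrightarrow> integrable \<mu> f"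
    if f: "f \<in> borel_measurable X" for f :: "'a \<Rightarrow> real"
  proof -
    have "f \<in> borel_measurable \<mu>" using f by (simp add: \<mu> cong: measurable_cong_sets)
    then have "integrable (distr (\<mu> \<Otimes>\<^sub>M \<nu>) \<mu> F) f \<longleftrightarrow> integrable (\<mu> \<Otimes>\<^sub>M \<nu>) (\<lambda>p. f (F p))"
      by (rule integrable_distr_eq[OF F'])
    then show ?thesis by (simp add: distr_F case_prod_unfold)
  qed
  moreover have "(\<integral>x. (\<integral>y. f (F (x, y)) \<partial>\<nu>) \<partial>\<mu>) = (\<integral>x. f x \<partial>\<mu>)"
    if f: "f \<in> borel_measurable X" for f :: "'a \<Rightarrow> real"
  proof -
    have fF: "(\<lambda>(x, y). f (F (x, y))) \<in> borel_measurable (X \<Otimes>\<^sub>M \<nu>)"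
      using measurable_compose[OF F f] by (simp add: case_prod_unfold)
    have "(\<integral>x. (\<integral>y. f (F (x, y)) \<partial>\<nu>) \<partial>\<mu>) = (\<integral>y. f (F (c, y)) \<partial>\<nu>)"
      unfolding \<mu> using c \<nu>.borel_measurable_lebesgue_integral[OF fF] by (rule integral_return)
    also have "\<dots> = (\<integral>y. f c \<partial>\<nu>)"
      by (rule Bochner_Integration.integral_cong) (simp_all add: fixed)
    also have "\<dots> = (\<integral>x. f x \<partial>\<mu>)"
      unfolding \<mu> using c f by (simp add: integral_return \<nu>.prob_space)
    finally show ?thesis .
  qed
  ultimately show ?thesis
    using V_meas inv unfolding Let_def \<mu>_def by (simp add: emeasure_distr)
qed

end
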